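(* Let $(m,p)=(2,3)$. For almost all $6$-tuples $(s_1,\dots,s_6)$ of distinct real numbers (i.e. for all such tuples outside the zero set of some nonzero real polynomial in $s_1,\dots,s_6$), the system $$\varphi_{2,3}(s_1;X)=\varphi_{2,3}(s_2;X)=\cdots=\varphi_{2,3}(s_6;X)=0$$ in the six entries of the $3\times 2$ matrix $X$ has exactly $5$ complex solutions, and all of them are real.
   Context: For integers $m,p\ge 2$ let $K(s)$ be the $m\times(m+p)$ matrix whose $(i,j)$ entry is $\binom{j-1}{i-1}s^{j-i}$ (zero when $j<i$); its rows are $\gamma(s),\gamma'(s),\dots,\gamma^{(m-1)}(s)/(m-1)!$ where $\gamma(s)=(1,s,\dots,s^{m+p-1})$. Let $X$ be a $p\times m$ matrix of indeterminates and $\varphi_{m,p}(s;X)=\det\begin{pmatrix}K(s)\\ I_p\ \ X\end{pmatrix}$, where $[I_p\ X]$ is the $p\times p$ identity matrix followed by $X$. *)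

theory Defs
  imports "Jordan_Normal_Form.Determinant"
begin

text \<open>The matrix K(s) stacked over [I_p X], 0-indexed. Rows 0..m-1 are
  K(s): entry (i,j) = binom(j,i) s^(j-i) for j >= i, else 0.
  Rows m..m+p-1 are [I_p X], with X a p x m matrix.\<close>
definition phi_mat :: "nat \<Rightarrow> nat \<Rightarrow> complex \<Rightarrow> complex mat \<Rightarrow> complex mat" where
  "phi_mat m p s X = mat (m + p) (m + p) (\<lambda>(i, j).
     if i < m then (if i \<le> j then of_nat (j choose i) * s ^ (j - i) else 0)
     else (let k = i - m in if j < p then (if j = k then 1 else 0) else X $$ (k, j - p)))"

definition phi :: "nat \<Rightarrow> nat \<Rightarrow> complex \<Rightarrow> complex mat \<Rightarrow> complex" where
  "phi m p s X = det (phi_mat m p s X)"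

inductive poly_fun :: "nat \<Rightarrow> ((nat \<Rightarrow> real) \<Rightarrow> real) \<Rightarrow> bool" for n where
  poly_const: "poly_fun n (\<lambda>s. c)"
| poly_var: "i < n \<Longrightarrow> poly_fun n (\<lambda>s. s i)"
| poly_add: "poly_fun n f \<Longrightarrow> poly_fun n g \<Longrightarrow> poly_fun n (\<lambda>s. f s + g s)"
| poly_mult: "poly_fun n f \<Longrightarrow> poly_fun n g \<Longrightarrow> poly_fun n (\<lambda>s. f s * g s)"

definition sol23 :: "(nat \<Rightarrow> real) \<Rightarrow> complex mat set" where
  "sol23 s = {X \<in> carrier_mat 3 2. \<forall>k<6. phi 2 3 (complex_of_real (s k)) X = 0}"

end

theory Submission
  imports Defs "Subresultants.Subresultant_Gcd" "HOL-Computational_Algebra.Fundamental_Theorem_Algebra"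
    "HOL-Computational_Algebra.Field_as_Ring"
begin

text \<open>
  \<open>\<phi>\<^sub>2\<^sub>,\<^sub>3(s;X)\<close> is the Wronskian at \<open>s\<close> of the monic polynomials
  \<open>f\<^sub>1 = x\<^sup>3 + a x\<^sup>2 + b x + c\<close> and \<open>f\<^sub>2 = x\<^sup>4 + d x\<^sup>2 + e x + f\<close> whose coefficients are
  the negated entries of \<open>X\<close>, so \<open>X\<close> solves the system iff \<open>f\<^sub>1 f\<^sub>2' - f\<^sub>1' f\<^sub>2 = \<Prod>(x - s\<^sub>i)\<close>.
  Comparing coefficients, all unknowns are determined by \<open>b\<close>, which for generic \<open>s\<close> runs through
  the roots of a squarefree real quintic.

  Reality of \<open>b\<close> comes from the Gaudin model. Translate so that \<open>s\<^sub>6 = 0\<close>. The span of \<open>f\<^sub>1, f\<^sub>2\<close>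
  contains some \<open>x\<^sup>2 h\<close>, where in the main case \<open>h\<close> is a monic quadratic. With \<open>H\<close> the
  polarization of \<open>h\<close>, the Bethe vector \<open>v\<^sub>i\<^sub>j = s\<^sub>i s\<^sub>j H(s\<^sub>i, s\<^sub>j) / (h(s\<^sub>i) h(s\<^sub>j))\<close>, indexed by
  the pairs in \<open>{1..5}\<close>, is an eigenvector of the real symmetric operator
  \<open>\<Sum>\<^sub>i\<^sub><\<^sub>j s\<^sub>i s\<^sub>j P\<^sub>i\<^sub>j\<close> (\<open>P\<^sub>i\<^sub>j\<close> the transposition), and its eigenvalue is affine in \<open>b\<close>.
\<close>

section \<open>The determinant as a Wronskian of a cubic and a quartic\<close>

lemma det_mat_2:
  fixes C :: "'a::comm_ring_1 mat"
  assumes "C \<in> carrier_mat 2 2"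
  shows "det C = C $$ (0,0) * C $$ (1,1) - C $$ (1,0) * C $$ (0,1)"
proof -
  have "det C = (\<Sum>i<2. C $$ (i,0) * cofactor C i 0)"
    by (rule laplace_expansion_column[OF assms]) simp
  also have "\<dots> = C $$ (0,0) * C $$ (1,1) - C $$ (1,0) * C $$ (0,1)"
    using assms by (simp add: numeral_2_eq_2 cofactor_def mat_delete_def det_single)
  finally show ?thesis .
qed

text \<open>Row elimination against the identity block clears the first three columns of K(s). What
  remains is a 2x2 block \<open>C\<close> whose columns list the value and the derivative at
  \<open>s\<close> of the cubic and of the quartic, so its determinant is their Wronskian.\<close>

lemma phi_2_3:
  assumes X: "X \<in> carrier_mat 3 2"
  shows "phi 2 3 s X =
     (s^3 - X$$(2,0) * s^2 - X$$(1,0) * s - X$$(0,0)) * (4 * s^3 - 2 * X$$(2,1) * s - X$$(1,1))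
     - (3 * s^2 - 2 * X$$(2,0) * s - X$$(1,0)) * (s^4 - X$$(2,1) * s^2 - X$$(1,1) * s - X$$(0,1))"
proof -
  define M where "M = phi_mat 2 3 s X"
  define K :: "nat \<Rightarrow> nat \<Rightarrow> complex" where "K i j = of_nat (j choose i) * s ^ (j - i)" for i j
  \<comment> \<open>Left multiplication by the unipotent \<open>L\<close> subtracts from row i < 2
    the sum of \<open>K i k\<close> times row k of \<open>[I_p X]\<close>.\<close>
  define L where "L = mat 5 5 (\<lambda>(i, j). if i = j then 1 else if i < 2 \<and> 2 \<le> j then - K i (j - 2) else 0)"
  define C where "C = mat 2 2 (\<lambda>(i, j). K i (j + 3) - (\<Sum>k<3. K i k * X $$ (k, j)))"
  have M: "M \<in> carrier_mat 5 5" and L: "L \<in> carrier_mat 5 5" and C: "C \<in> carrier_mat 2 2"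
    by (simp_all add: M_def phi_mat_def L_def C_def)
  have five: "{..<5::nat} = {0,1,2,3,4}" by auto
  have LM: "(L * M) $$ (i, j) = (\<Sum>k<5. L $$ (i, k) * M $$ (k, j))" if "i < 5" "j < 5" for i j
    using that L M by (simp add: scalar_prod_def lessThan_atLeast0)
  have "det L = prod_list (diag_mat L)"
    by (rule det_upper_triangular[OF _ L]) (auto simp: L_def upper_triangular_def)
  also have "\<dots> = 1" by (simp add: diag_mat_def L_def upt_rec)
  finally have "det M = det (L * M)" using det_mult[OF L M] by simp
  \<comment> \<open>Moving two rows below three others costs the sign (-1)^6 = 1.\<close>
  also have "\<dots> = det (mat 5 5 (\<lambda>(i,j). (L * M) $$ (if i < 3 then i + 2 else i - 3, j)))"
    by (subst det_swap_rows[of _ 3 2]) (use L M in \<open>auto simp: case_prod_unfold\<close>)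
  also have "mat 5 5 (\<lambda>(i,j). (L * M) $$ (if i < 3 then i + 2 else i - 3, j)) = four_block_mat (1\<^sub>m 3) X (0\<^sub>m 2 3) C"
  proof (rule eq_matI)
    fix i j
    assume "i < dim_row (four_block_mat (1\<^sub>m 3) X (0\<^sub>m 2 3) C)" "j < dim_col (four_block_mat (1\<^sub>m 3) X (0\<^sub>m 2 3) C)"
    then have "i \<in> {0,1,2,3,4}" "j \<in> {0,1,2,3,4}" using C by auto
    then show "mat 5 5 (\<lambda>(i,j). (L * M) $$ (if i < 3 then i + 2 else i - 3, j)) $$ (i, j)
      = four_block_mat (1\<^sub>m 3) X (0\<^sub>m 2 3) C $$ (i, j)"
      using X C
      by (elim insertE emptyE; simp add: LM)
        (simp_all add: five L_def M_def phi_mat_def C_def K_def numeral_eq_Suc algebra_simps)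
  qed (use C X in auto)
  finally have "phi 2 3 s X = det C"
    unfolding phi_def M_def[symmetric]
    using det_four_block_mat_lower_left_zero[OF one_carrier_mat X refl C] by simp
  also have "\<dots> = C $$ (0,0) * C $$ (1,1) - C $$ (1,0) * C $$ (0,1)" by (rule det_mat_2[OF C])
  finally show ?thesis
    by (simp add: C_def K_def numeral_eq_Suc algebra_simps)
qed

section \<open>Interpolation sums and real eigenvalues\<close>

text \<open>Lagrange interpolation reproduces \<open>p\<close> from its values at the nodes. Each
  basis product is monic of degree \<open>card I - 1\<close>, so comparing coefficients in that
  degree gives the sum.\<close>

lemma sum_poly_over_node_products:
  fixes p :: "'a::field poly" and s :: "'b \<Rightarrow> 'a"
  assumes I: "finite I" "I \<noteq> {}" and inj: "inj_on s I" and deg: "degree p < card I"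
  shows "(\<Sum>k\<in>I. poly p (s k) / (\<Prod>j\<in>I-{k}. s k - s j)) = coeff p (card I - 1)"
proof -
  define L where "L k = (\<Prod>j\<in>I-{k}. [:- s j, 1:])" for k
  define q where "q = (\<Sum>k\<in>I. smult (poly p (s k) / (\<Prod>j\<in>I-{k}. s k - s j)) (L k))"
  have degL: "degree (L k) = card I - 1" and lcL: "lead_coeff (L k) = 1" if "k \<in> I" for k
  proof -
    show "degree (L k) = card I - 1"
      using that I by (simp add: L_def degree_prod_eq_sum_degree)
    show "lead_coeff (L k) = 1" unfolding L_def lead_coeff_prod by simp
  qed
  have L: "poly (L k) (s i) = (if i = k then (\<Prod>j\<in>I-{k}. s k - s j) else 0)" if "i \<in> I" "k \<in> I" for i k
    using that I by (auto simp: L_def poly_prod)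
  have nz: "(\<Prod>j\<in>I-{k}. s k - s j) \<noteq> 0" if "k \<in> I" for k
    using that inj I by (auto simp: inj_on_def)
  have "p = q"
  proof (rule poly_eqI_degree[of "s ` I"])
    fix x assume "x \<in> s ` I"
    then obtain i where i: "i \<in> I" "x = s i" by auto
    have "poly q x = (\<Sum>k\<in>I. if k = i then poly p (s i) else 0)"
      unfolding q_def poly_sum using i L nz by (intro sum.cong) auto
    then show "poly p x = poly q x" using i I by simp
  next
    show "card (s ` I) > degree p" using deg inj by (simp add: card_image)
    have "degree q \<le> card I - 1" unfolding q_def
      by (intro degree_sum_le I order.trans[OF degree_smult_le]) (simp add: degL)
    then show "card (s ` I) > degree q" using deg inj by (simp add: card_image)
  qed
  then have "coeff p (card I - 1) = coeff q (card I - 1)" by simp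
  also have "\<dots> = (\<Sum>k\<in>I. poly p (s k) / (\<Prod>j\<in>I-{k}. s k - s j))"
    unfolding q_def coeff_sum using degL lcL by (intro sum.cong) auto
  finally show ?thesis ..
qed

text \<open>
  Pairing the eigenvalue equation with \<open>v\<close> gives \<open>l \<Sum>|v\<^sub>i\<^sub>j|\<^sup>2 = \<Sum> A\<^sub>i\<^sub>j |v\<^sub>i\<^sub>j|\<^sup>2 + 2 \<Sum>|w\<^sub>j|\<^sup>2\<close>
  with \<open>w\<^sub>j = \<Sum>\<^sub>k s\<^sub>k v\<^sub>k\<^sub>j\<close>.
\<close>
lemma real_eigenvalue_of_rank_one_coupling:
  fixes v :: "'b \<Rightarrow> 'b \<Rightarrow> complex" and A :: "'b \<Rightarrow> 'b \<Rightarrow> real" and s :: "'b \<Rightarrow> real"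
  assumes I: "finite I" and sym: "\<And>i j. v i j = v j i" and diag: "\<And>i. v i i = 0"
    and eig: "\<And>i j. i \<in> I \<Longrightarrow> j \<in> I \<Longrightarrow> i \<noteq> j \<Longrightarrow>
      l * v i j = A i j * v i j + s i * (\<Sum>k\<in>I. s k * v k j) + s j * (\<Sum>k\<in>I. s k * v k i)"
    and nz: "i0 \<in> I" "j0 \<in> I" "v i0 j0 \<noteq> 0"
  shows "l \<in> \<real>"
proof -
  define w where "w j = (\<Sum>k\<in>I. s k * v k j)" for j
  define n where "n = (\<Sum>i\<in>I. \<Sum>j\<in>I. (cmod (v i j))\<^sup>2)"
  have cnj_w: "(\<Sum>k\<in>I. s k * cnj (v k j)) = cnj (w j)" for j by (simp add: w_def)
  have "l * n = (\<Sum>i\<in>I. \<Sum>j\<in>I. cnj (v i j) * (l * v i j))"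
    unfolding n_def of_real_sum sum_distrib_left
    by (intro sum.cong refl) (simp add: complex_norm_square mult_ac del: of_real_power)
  also have "\<dots> = (\<Sum>i\<in>I. \<Sum>j\<in>I. cnj (v i j) * (A i j * v i j + s i * w j + s j * w i))"
  proof (intro sum.cong refl)
    fix i j assume "i \<in> I" "j \<in> I"
    then show "cnj (v i j) * (l * v i j) = cnj (v i j) * (A i j * v i j + s i * w j + s j * w i)"
      by (cases "i = j") (simp_all add: diag eig w_def)
  qed
  also have "\<dots> = (\<Sum>i\<in>I. \<Sum>j\<in>I. A i j * (cnj (v i j) * v i j))
     + (\<Sum>i\<in>I. \<Sum>j\<in>I. w j * (s i * cnj (v i j))) + (\<Sum>i\<in>I. \<Sum>j\<in>I. w i * (s j * cnj (v i j)))"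
    by (simp add: algebra_simps sum.distrib)
  also have "(\<Sum>i\<in>I. \<Sum>j\<in>I. w j * (s i * cnj (v i j))) = (\<Sum>j\<in>I. w j * cnj (w j))"
    by (subst sum.swap) (simp only: sum_distrib_left[symmetric] cnj_w)
  also have "(\<Sum>i\<in>I. \<Sum>j\<in>I. w i * (s j * cnj (v i j))) = (\<Sum>j\<in>I. w j * cnj (w j))"
    by (subst sym) (simp only: sum_distrib_left[symmetric] cnj_w)
  also have "(\<Sum>i\<in>I. \<Sum>j\<in>I. A i j * (cnj (v i j) * v i j)) + (\<Sum>j\<in>I. w j * cnj (w j)) + (\<Sum>j\<in>I. w j * cnj (w j))
    = of_real ((\<Sum>i\<in>I. \<Sum>j\<in>I. A i j * (cmod (v i j))\<^sup>2) + 2 * (\<Sum>j\<in>I. (cmod (w j))\<^sup>2))"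
    by (simp add: complex_norm_square mult_ac del: of_real_power)
  finally have ln: "l * n \<in> \<real>" by simp
  have "n > 0"
    unfolding n_def
  proof (rule sum_pos2[OF I nz(1)])
    show "0 < (\<Sum>j\<in>I. (cmod (v i0 j))\<^sup>2)"
      by (rule sum_pos2[OF I nz(2)]) (use nz in auto)
  qed (simp add: sum_nonneg)
  then have "l = (l * n) / n" by simp
  with ln show ?thesis by (metis Reals_divide Reals_of_real)
qed

section \<open>Reality of \<open>b\<close> when one node is 0\<close>

text \<open>The coefficients of x^3, x^4, x^5 are linear in the unknowns and those of 1, x, x^2 are
  quadratic, which is what later allows elimination down to \<open>b\<close>. The leading
  coefficient is 4 - 3 = 1.\<close>

lemma wronskian_coeffs:
  fixes x :: "'a::comm_ring_1"
  shows "(x^3 + a * x^2 + b * x + c) * (4 * x^3 + 2 * d * x + e)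
      - (3 * x^2 + 2 * a * x + b) * (x^4 + d * x^2 + e * x + f)
    = poly [:c * e - b * f, 2 * c * d - 2 * a * f, b * d - a * e - 3 * f, 4 * c - 2 * e, 3 * b - d, 2 * a, 1:] x"
  by (simp add: algebra_simps power_numeral_reduce)

lemma poly_eq_coeff_list_6:
  assumes "degree p \<le> 6"
  shows "p = [:coeff p 0, coeff p 1, coeff p 2, coeff p 3, coeff p 4, coeff p 5, coeff p 6:]"
proof (rule poly_eqI)
  fix n show "coeff p n = coeff [:coeff p 0, coeff p 1, coeff p 2, coeff p 3, coeff p 4, coeff p 5, coeff p 6:] n"
    using assms coeff_eq_0[of p n]
    by (auto simp: coeff_pCons numeral_eq_Suc split: nat.splits)
qed

lemma coeff_prod_linear_Reals:
  fixes s :: "'b \<Rightarrow> real"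
  shows "coeff (\<Prod>i\<in>I. [:- complex_of_real (s i), 1:]) n \<in> \<real>"
proof (induction I arbitrary: n rule: infinite_finite_induct)
  case (insert i I)
  then show ?case by (auto simp: coeff_pCons split: nat.split intro!: Reals_diff Reals_mult)
qed (auto simp: coeff_1)

lemma poly_pderiv_prod_linear:
  fixes s :: "'b \<Rightarrow> 'a::idom"
  assumes "finite I" "k \<in> I"
  shows "poly (pderiv (\<Prod>i\<in>I. [:- s i, 1:])) (s k) = (\<Prod>j\<in>I-{k}. s k - s j)"
proof -
  have "(\<Prod>i\<in>I. [:- s i, 1:]) = [:- s k, 1:] * (\<Prod>i\<in>I-{k}. [:- s i, 1:])"
    using assms by (rule prod.remove)
  then show ?thesis by (simp add: pderiv_mult pderiv_pCons poly_prod del: mult_pCons_left)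
qed

text \<open>Turns a polynomial identity in \<open>H\<close>, \<open>h\<close>, \<open>k\<close> into
  the eigenvalue equation for the Bethe vector with entries
  \<open>x * y * H / (h * k)\<close>.\<close>

lemma distribute_over_two_denominators:
  fixes x y :: "'a::field"
  assumes "h \<noteq> 0" "k \<noteq> 0"
  shows "x * y / (h * k) * (A * H + h * P + k * Q)
    = A * (x * y * H / (h * k)) + x * (y / k * P) + y * (x / h * Q)"
  using assms by (simp add: field_simps)

lemma wronskian_node_at_0_real:
  fixes s :: "'b \<Rightarrow> real" and a b c d e f :: complex
  assumes card: "card I = 5" and inj: "inj_on s I" and s0: "\<And>i. i \<in> I \<Longrightarrow> s i \<noteq> 0"
    and W: "\<And>x. (x^3 + a * x^2 + b * x + c) * (4 * x^3 + 2 * d * x + e)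
      - (3 * x^2 + 2 * a * x + b) * (x^4 + d * x^2 + e * x + f) = x * (\<Prod>i\<in>I. x - of_real (s i))"
  shows "b \<in> \<real>"
proof -
  have fin: "finite I" and ne: "I \<noteq> {}" using card by (auto intro: card_ge_0_finite)
  define z where "z i = complex_of_real (s i)" for i
  have injz: "inj_on z I" using inj by (auto simp: inj_on_def z_def)
  have z0: "z i \<noteq> 0" if "i \<in> I" for i using s0[OF that] by (simp add: z_def)
  define R where "R = (\<Prod>i\<in>I. [:- z i, 1:])"
  define r where "r = coeff R"
  have r_real: "r n \<in> \<real>" for n
    unfolding r_def R_def z_def by (rule coeff_prod_linear_Reals)
  have deg: "degree R = 5" unfolding R_def by (simp add: degree_prod_eq_sum_degree card)
  have "lead_coeff R = 1" unfolding R_def lead_coeff_prod by simp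
  then have "r 5 = 1" "r 6 = 0" using deg by (simp_all add: r_def coeff_eq_0)
  moreover have "R = [:r 0, r 1, r 2, r 3, r 4, r 5, r 6:]"
    unfolding r_def by (rule poly_eq_coeff_list_6) (simp add: deg)
  ultimately have R: "R = [:r 0, r 1, r 2, r 3, r 4, 1:]" by simp
  have R_prod: "poly R x = (\<Prod>i\<in>I. x - z i)" for x by (simp add: R_def poly_prod)
  have "poly [:c * e - b * f, 2 * c * d - 2 * a * f, b * d - a * e - 3 * f, 4 * c - 2 * e, 3 * b - d, 2 * a, 1:] x
     = poly (pCons 0 R) x" for x
    using W[of x] by (simp only: wronskian_coeffs poly_pCons[of 0 R] R_prod z_def) simp
  then have "[:c * e - b * f, 2 * c * d - 2 * a * f, b * d - a * e - 3 * f, 4 * c - 2 * e, 3 * b - d, 2 * a, 1:] = pCons 0 R"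
    by (intro poly_eq_poly_eq_iff[THEN iffD1] ext)
  then have coeffs: "c * e = b * f" "2 * c * d - 2 * a * f = r 0" "b * d - a * e - 3 * f = r 1"
    "4 * c - 2 * e = r 2" "3 * b - d = r 3" "2 * a = r 4"
    unfolding R pCons_eq_iff right_minus_eq by blast+
  have a_real: "a \<in> \<real>"
  proof -
    have "a = r 4 / 2" by (simp flip: coeffs(6))
    also have "\<dots> \<in> \<real>" using r_real[of 4] by (intro Reals_divide) auto
    finally show ?thesis .
  qed
  have b_if_d: "b \<in> \<real>" if "d \<in> \<real>"
  proof -
    have "b = (r 3 + d) / 3" using coeffs(5) by (simp add: field_simps)
    also have "\<dots> \<in> \<real>" using r_real[of 3] that by (intro Reals_divide Reals_add) auto
    finally show ?thesis .
  qed
  show ?thesis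
  proof (cases "b = 0 \<and> c = 0")
    case False
    \<comment> \<open>Since \<open>c * e = b * f\<close>, the pair \<open>(e, f)\<close> is a
      multiple of the nonzero pair \<open>(b, c)\<close>. Subtracting \<mu> times the cubic from the
      quartic then leaves x^2 h(x) with h(x) = x^2 - \<mu> x + q.\<close>
    obtain \<mu> where \<mu>: "e = \<mu> * b" "f = \<mu> * c"
    proof (cases "b = 0")
      case True
      then show ?thesis using False coeffs(1) that[of "f / c"] by simp
    next
      case b: False
      then show ?thesis using coeffs(1) that[of "e / b"] by (simp add: field_simps)
    qed
    define q where "q = d - \<mu> * a"
    have d: "d = q + \<mu> * a" by (simp add: q_def)
    have rs: "r 0 = 2 * c * q" "r 1 = q * b - 3 * \<mu> * c" "r 2 = 4 * c - 2 * \<mu> * b"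
      "r 3 = 3 * b - q - \<mu> * a" "r 4 = 2 * a"
      using coeffs unfolding \<mu> d by (auto simp: algebra_simps)
    define h where "h x = x^2 - \<mu> * x + q" for x
    define Z where "Z x = 2 * x^4 - 6 * b * x^2 + (2 * \<mu> * b - 16 * c) * x + 6 * \<mu> * c" for x
    define D where "D k = (\<Prod>j\<in>I-{k}. z k - z j)" for k
    have R': "poly (pderiv R) x = 5 * x^4 + 4 * r 4 * x^3 + 3 * r 3 * x^2 + 2 * r 2 * x + r 1" for x
      unfolding R by (simp add: pderiv_pCons algebra_simps power_numeral_reduce)
    have Rk: "poly R (z k) = 0" and R'k: "poly (pderiv R) (z k) = D k" and D0: "D k \<noteq> 0" if "k \<in> I" for k
    proof -
      show "poly R (z k) = 0" using that fin by (auto simp: R_prod)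
      show "poly (pderiv R) (z k) = D k"
        unfolding R_def D_def using fin that by (rule poly_pderiv_prod_linear)
      show "D k \<noteq> 0" unfolding D_def using that injz fin by (auto simp: inj_on_def)
    qed
    \<comment> \<open>The differential equation satisfied by \<open>x\<^sup>2 h\<close>; \<open>Z\<close> is the exact quotient by \<open>h\<close>.\<close>
    have ode: "(2 * x^2 - \<mu> * x) * poly (pderiv R) x - (8 * x - 3 * \<mu>) * poly R x = h x * Z x" for x
      unfolding R' unfolding R rs h_def Z_def by (simp add: algebra_simps power_numeral_reduce)
    have ode_k: "z k * (2 * z k - \<mu>) * D k = h (z k) * Z (z k)" if "k \<in> I" for k
      using ode[of "z k"] by (simp add: Rk R'k that power2_eq_square algebra_simps)
    show ?thesis
    proof (cases "\<exists>k\<in>I. h (z k) = 0")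
      case True
      then obtain k where k: "k \<in> I" "h (z k) = 0" by blast
      \<comment> \<open>The roots of the Wronskian are simple, so a common root with \<open>h\<close> is a double root of \<open>h\<close>.\<close>
      then have "2 * z k - \<mu> = 0" using ode_k[OF k(1)] D0[OF k(1)] z0[OF k(1)] by simp
      then have mu: "\<mu> = 2 * z k" by simp
      with k(2) have "q = z k ^ 2" by (simp add: h_def power2_eq_square)
      with mu have "d \<in> \<real>" unfolding d using a_real by (auto simp: z_def intro!: Reals_add Reals_mult)
      then show ?thesis by (rule b_if_d)
    next
      case False
      then have h0: "h (z k) \<noteq> 0" if "k \<in> I" for k using that by blast
      define H where "H x y = x * y - \<mu> * (x + y) / 2 + q" for x y
      have H_sym: "H x y = H y x" for x y by (simp add: H_def algebra_simps)
      have H_diag: "H x x = h x" for x by (simp add: H_def h_def power2_eq_square)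
      \<comment> \<open>The right side is d - 2 a x. This closed form computes the coupling sums of
        the Bethe vector, once the term of the node itself is removed.\<close>
      have F: "(\<Sum>k\<in>I. z k ^ 2 * H (z k) x / h (z k)) = q + \<mu> * a - 2 * a * x" for x
      proof -
        \<comment> \<open>\<open>p\<close> reduces \<open>u\<^sup>2 R'(u) + u (x - u) Z(u) / 2\<close> modulo \<open>R\<close> to degree at most 4.\<close>
        define p where "p = [:- x * r 0, 3 * x * \<mu> * c - 4 * r 0 - x * r 1,
          x * (\<mu> * b - 8 * c) - 3 * \<mu> * c - 3 * r 1 - x * r 2,
          8 * c - \<mu> * b - 2 * r 2 - 3 * b * x - x * r 3, 3 * b - r 3 - x * r 4:]"
        have p: "poly p u = u^2 * poly (pderiv R) u + u * (x - u) * Z u / 2 - (4 * u + x) * poly R u" for u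
          unfolding R' unfolding R p_def Z_def by (simp add: field_simps power_numeral_reduce)
        have "z k ^ 2 * H (z k) x / h (z k) = poly p (z k) / D k" if k: "k \<in> I" for k
        proof -
          \<comment> \<open>The polarization of a quadratic is H(u, x) = h(u) + (x - u) h'(u) / 2.
            With \<open>ode_k\<close> the term containing h'(u) = 2 u - \<mu> acquires a factor
            h(u), which cancels the denominator.\<close>
          have "2 * H (z k) x = 2 * h (z k) + (x - z k) * (2 * z k - \<mu>)"
            by (simp add: H_def h_def field_simps power2_eq_square)
          then have "z k ^ 2 * D k * (2 * H (z k) x) = z k ^ 2 * D k * (2 * h (z k) + (x - z k) * (2 * z k - \<mu>))"
            by simp
          then have "2 * D k * (z k ^ 2 * H (z k) x)
            = 2 * z k ^ 2 * D k * h (z k) + z k * (x - z k) * (z k * (2 * z k - \<mu>) * D k)"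
            by (simp add: algebra_simps power2_eq_square)
          also have "\<dots> = 2 * poly p (z k) * h (z k)"
            unfolding ode_k[OF k] p by (simp add: Rk R'k k field_simps)
          finally show ?thesis using D0[OF k] h0[OF k] by (simp add: field_simps)
        qed
        then have "(\<Sum>k\<in>I. z k ^ 2 * H (z k) x / h (z k)) = (\<Sum>k\<in>I. poly p (z k) / D k)"
          by simp
        also have "\<dots> = coeff p 4"
          unfolding D_def using sum_poly_over_node_products[OF fin ne injz, of p]
          by (simp add: card p_def le_imp_less_Suc)
        also have "\<dots> = q + \<mu> * a - 2 * a * x"
          unfolding p_def rs by (simp add: numeral_eq_Suc)
        finally show ?thesis .
      qed
      \<comment> \<open>The zero diagonal lets the coupling sums run over all of
        \<open>I\<close>.\<close>
      define v where "v i j = (if i = j then 0 else z i * z j * H (z i) (z j) / (h (z i) * h (z j)))" for i j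
      have w: "(\<Sum>k\<in>I. z k * v k j) = z j / h (z j) * (q + \<mu> * a - 2 * a * z j - z j ^ 2)" if j: "j \<in> I" for j
      proof -
        have "(\<Sum>k\<in>I. z k * v k j) = (\<Sum>k\<in>I-{j}. z k * v k j)"
          using fin j by (subst sum.remove) (auto simp: v_def)
        also have "\<dots> = (\<Sum>k\<in>I-{j}. z j / h (z j) * (z k ^ 2 * H (z k) (z j) / h (z k)))"
          by (intro sum.cong) (auto simp: v_def power2_eq_square mult_ac)
        also have "\<dots> = z j / h (z j) * (\<Sum>k\<in>I-{j}. z k ^ 2 * H (z k) (z j) / h (z k))"
          by (simp only: sum_distrib_left)
        also have "(\<Sum>k\<in>I-{j}. z k ^ 2 * H (z k) (z j) / h (z k)) = q + \<mu> * a - 2 * a * z j - z j ^ 2"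
          using F[of "z j"] sum.remove[OF fin j, of "\<lambda>k. z k ^ 2 * H (z k) (z j) / h (z k)"] h0[OF j]
          by (simp add: H_diag algebra_simps)
        finally show ?thesis .
      qed
      obtain \<alpha> where \<alpha>: "a = complex_of_real \<alpha>" using a_real by (auto elim: Reals_cases)
      obtain \<rho> where \<rho>: "r 3 = complex_of_real \<rho>" using r_real[of 3] by (auto elim: Reals_cases)
      \<comment> \<open>This is the diagonal coefficient of the Gaudin operator at the pair {i, j},
        after the off-diagonal sums are completed to all \<open>k\<close>. Here \<open>r 3\<close>
        and \<open>- 2 * a\<close> are the second and first elementary symmetric functions of the
        nodes.\<close>
      define A where "A i j = \<rho> + 2 * \<alpha> * (s i + s j) + 2 * s i * s j" for i j
      have A: "complex_of_real (A i j) = r 3 + 2 * a * (z i + z j) + 2 * z i * z j" for i j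
        by (simp add: A_def \<alpha> \<rho> z_def)
      obtain i0 j0 where ij: "i0 \<in> I" "j0 \<in> I" "v i0 j0 \<noteq> 0"
      proof -
        obtain i where i: "i \<in> I" using ne by blast
        have "card (I - {i}) = 4" using card i fin by simp
        then obtain T where "T \<subseteq> I - {i}" "card T = 2" using obtain_subset_with_card_n[of 2 "I - {i}"] by auto
        then obtain j k where jk: "j \<in> I" "k \<in> I" "j \<noteq> i" "k \<noteq> i" "j \<noteq> k"
          by (auto simp: card_2_iff)
        \<comment> \<open>\<open>H (z i)\<close> is affine in its second argument. Two distinct
          zeros would make it vanish identically, and then \<open>h (z i) = H (z i) (z i)\<close>
          would be 0.\<close>
        have "H (z i) (z j) \<noteq> 0 \<or> H (z i) (z k) \<noteq> 0"
        proof (rule ccontr)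
          assume "\<not> ?thesis"
          then have 0: "H (z i) (z j) = 0" "H (z i) (z k) = 0" by auto
          have "H (z i) (z j) - H (z i) (z k) = (z i - \<mu> / 2) * (z j - z k)"
            by (simp add: H_def field_simps)
          then have "z i - \<mu> / 2 = 0" using 0 jk injz by (auto simp: inj_on_def)
          moreover have "h (z i) = H (z i) (z j) + (z i - \<mu> / 2) * (z i - z j)"
            by (simp add: H_def h_def field_simps power2_eq_square)
          ultimately show False using 0 h0[OF i] by simp
        qed
        then show ?thesis using that[of i j] that[of i k] jk i z0 h0 by (auto simp: v_def)
      qed
      \<comment> \<open>As \<open>d = 3 * b - r 3\<close>, this eigenvalue equals
        \<open>6 * b - r 3\<close>.\<close>
      have "r 3 + 2 * d \<in> \<real>"
      proof (rule real_eigenvalue_of_rank_one_coupling[where v = v and A = A and s = s and I = I])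
        fix i j assume i: "i \<in> I" and j: "j \<in> I" and neq: "i \<noteq> j"
        have key: "(r 3 + 2 * d) * H (z i) (z j) = complex_of_real (A i j) * H (z i) (z j)
          + h (z i) * (q + \<mu> * a - 2 * a * z j - z j ^ 2) + h (z j) * (q + \<mu> * a - 2 * a * z i - z i ^ 2)"
          unfolding A d H_def h_def by (simp add: field_simps power2_eq_square)
        have "(r 3 + 2 * d) * v i j = z i * z j / (h (z i) * h (z j)) * ((r 3 + 2 * d) * H (z i) (z j))"
          using neq by (simp add: v_def)
        also have "\<dots> = of_real (A i j) * v i j + z i * (\<Sum>k\<in>I. z k * v k j) + z j * (\<Sum>k\<in>I. z k * v k i)"
          unfolding key w[OF i] w[OF j] using neq
          by (simp only: v_def if_False distribute_over_two_denominators[OF h0[OF i] h0[OF j]])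
        finally show "(r 3 + 2 * d) * v i j = complex_of_real (A i j) * v i j +
           complex_of_real (s i) * (\<Sum>k\<in>I. complex_of_real (s k) * v k j) +
           complex_of_real (s j) * (\<Sum>k\<in>I. complex_of_real (s k) * v k i)"
          unfolding z_def .
      qed (use fin ij in \<open>auto simp: v_def H_sym mult.commute\<close>)
      then have "(r 3 + 2 * d - r 3) / 2 \<in> \<real>" using r_real[of 3] by (intro Reals_divide Reals_diff) auto
      then show ?thesis by (intro b_if_d) simp
    qed
  qed simp
qed

section \<open>The eliminant quintic and the genericity condition\<close>

definition wronskian_target :: "(nat \<Rightarrow> real) \<Rightarrow> real poly" where
  "wronskian_target s = (\<Prod>i<6. [:- s i, 1:])"

text \<open>
  With \<open>w\<^sub>0, \<dots>, w\<^sub>5\<close> the lower coefficients of the prescribed Wronskian, elimination leaves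
  the linear equation \<open>c D(b) = N(b)\<close> for \<open>c\<close>, where \<open>D\<close> and \<open>N\<close> are the next two polynomials;
  the quintic is the remaining equation multiplied by \<open>D\<^sup>2\<close>.
\<close>
definition elim_denom :: "(nat \<Rightarrow> real) \<Rightarrow> real poly" where
  "elim_denom w = [:w 5 ^ 2 / 6 - w 4, 3:]"

definition elim_numer :: "(nat \<Rightarrow> real) \<Rightarrow> real poly" where
  "elim_numer w = [:w 1 / 2 + w 5 / 6 * (w 5 * w 3 / 4 - w 2), - (w 5 / 6 * w 4), w 5 / 2:]"

definition elim_quintic :: "(nat \<Rightarrow> real) \<Rightarrow> real poly" where
  "elim_quintic w = smult 2 (elim_numer w ^ 2) + elim_numer w * elim_denom w * [:- w 3 / 2, w 5 / 3:]
     - elim_denom w ^ 2 * [:w 0, (w 5 * w 3 / 4 - w 2) / 3, - w 4 / 3, 1:]"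

text \<open>The first factor is \<open>N\<close> at the root of \<open>D\<close>.\<close>
definition genericity :: "(nat \<Rightarrow> real) \<Rightarrow> real" where
  "genericity w = poly (elim_numer w) (w 4 / 3 - w 5 ^ 2 / 18) * resultant (elim_quintic w) (pderiv (elim_quintic w))"

section \<open>Polynomial dependence of the genericity condition on the nodes\<close>

lemma poly_fun_sum: "(\<And>i. i \<in> A \<Longrightarrow> poly_fun n (f i)) \<Longrightarrow> poly_fun n (\<lambda>s. \<Sum>i\<in>A. f i s)"
  by (induction A rule: infinite_finite_induct) (auto intro: poly_fun.intros)

lemma poly_fun_prod: "(\<And>i. i \<in> A \<Longrightarrow> poly_fun n (f i)) \<Longrightarrow> poly_fun n (\<lambda>s. \<Prod>i\<in>A. f i s)"
  by (induction A rule: infinite_finite_induct) (auto intro: poly_fun.intros)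

lemma poly_fun_power: "poly_fun n f \<Longrightarrow> poly_fun n (\<lambda>s. f s ^ k)"
  by (induction k) (auto intro: poly_fun.intros)

lemma poly_fun_uminus: "poly_fun n f \<Longrightarrow> poly_fun n (\<lambda>s. - f s)"
  using poly_mult[OF poly_const[of n "-1"], of f] by simp

lemma poly_fun_diff: "poly_fun n f \<Longrightarrow> poly_fun n g \<Longrightarrow> poly_fun n (\<lambda>s. f s - g s)"
  using poly_add[of n f, OF _ poly_fun_uminus[of n g]] by simp

lemma poly_fun_divide: "poly_fun n f \<Longrightarrow> poly_fun n (\<lambda>s. f s / c)"
  using poly_mult[of n f, OF _ poly_const[of n "1 / c"]] by simp

lemma poly_fun_if: "(c \<Longrightarrow> poly_fun n f) \<Longrightarrow> (\<not> c \<Longrightarrow> poly_fun n g) \<Longrightarrow> poly_fun n (\<lambda>s. if c then f s else g s)"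
  by (cases c) simp_all

lemmas poly_fun_closed = poly_fun.intros poly_fun_sum poly_fun_prod poly_fun_power poly_fun_uminus
  poly_fun_diff poly_fun_divide

lemma poly_fun_det:
  assumes "\<And>s. M s \<in> carrier_mat m m"
    and "\<And>i j. i < m \<Longrightarrow> j < m \<Longrightarrow> poly_fun n (\<lambda>s. M s $$ (i, j))"
  shows "poly_fun n (\<lambda>s. det (M s))"
proof -
  have "poly_fun n (\<lambda>s. \<Sum>p | p permutes {0..<m}. signof p * (\<Prod>i = 0..<m. M s $$ (i, p i)))"
    using assms(2) by (intro poly_fun_closed) (auto simp: permutes_in_image)
  then show ?thesis using det_def'[OF assms(1)] by (simp cong: if_cong)
qed

definition poly_coeffs_fun :: "nat \<Rightarrow> ((nat \<Rightarrow> real) \<Rightarrow> real poly) \<Rightarrow> bool" where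
  "poly_coeffs_fun n p \<longleftrightarrow> (\<forall>i. poly_fun n (\<lambda>s. coeff (p s) i))"

lemma poly_coeffs_fun_0: "poly_coeffs_fun n (\<lambda>s. 0)"
  by (simp add: poly_coeffs_fun_def poly_fun_closed)

lemma poly_coeffs_fun_1: "poly_coeffs_fun n (\<lambda>s. 1)"
  by (simp add: poly_coeffs_fun_def poly_fun_closed)

lemma poly_coeffs_fun_pCons:
  assumes "poly_fun n c" "poly_coeffs_fun n p"
  shows "poly_coeffs_fun n (\<lambda>s. pCons (c s) (p s))"
  unfolding poly_coeffs_fun_def
proof
  fix i show "poly_fun n (\<lambda>s. coeff (pCons (c s) (p s)) i)"
    using assms by (cases i) (auto simp: poly_coeffs_fun_def)
qed

lemma poly_coeffs_fun_add: "poly_coeffs_fun n p \<Longrightarrow> poly_coeffs_fun n q \<Longrightarrow> poly_coeffs_fun n (\<lambda>s. p s + q s)"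
  by (simp add: poly_coeffs_fun_def poly_fun_closed)

lemma poly_coeffs_fun_diff: "poly_coeffs_fun n p \<Longrightarrow> poly_coeffs_fun n q \<Longrightarrow> poly_coeffs_fun n (\<lambda>s. p s - q s)"
  by (simp add: poly_coeffs_fun_def poly_fun_closed)

lemma poly_coeffs_fun_smult: "poly_fun n c \<Longrightarrow> poly_coeffs_fun n p \<Longrightarrow> poly_coeffs_fun n (\<lambda>s. smult (c s) (p s))"
  by (simp add: poly_coeffs_fun_def poly_fun_closed)

lemma poly_coeffs_fun_mult: "poly_coeffs_fun n p \<Longrightarrow> poly_coeffs_fun n q \<Longrightarrow> poly_coeffs_fun n (\<lambda>s. p s * q s)"
  by (simp add: poly_coeffs_fun_def coeff_mult poly_fun_closed)

lemma poly_coeffs_fun_prod: "(\<And>i. i \<in> A \<Longrightarrow> poly_coeffs_fun n (p i)) \<Longrightarrow> poly_coeffs_fun n (\<lambda>s. \<Prod>i\<in>A. p i s)"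
  by (induction A rule: infinite_finite_induct) (auto intro: poly_coeffs_fun_1 poly_coeffs_fun_mult)

lemma poly_coeffs_fun_power: "poly_coeffs_fun n p \<Longrightarrow> poly_coeffs_fun n (\<lambda>s. p s ^ k)"
  by (induction k) (auto intro: poly_coeffs_fun_1 poly_coeffs_fun_mult)

lemma poly_coeffs_fun_pderiv: "poly_coeffs_fun n p \<Longrightarrow> poly_coeffs_fun n (\<lambda>s. pderiv (p s))"
  unfolding poly_coeffs_fun_def coeff_pderiv by (auto intro: poly_fun_closed)

lemmas poly_coeffs_fun_closed = poly_coeffs_fun_0 poly_coeffs_fun_1 poly_coeffs_fun_pCons
  poly_coeffs_fun_add poly_coeffs_fun_diff poly_coeffs_fun_smult poly_coeffs_fun_mult
  poly_coeffs_fun_prod poly_coeffs_fun_power poly_coeffs_fun_pderiv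

text \<open>Constant degrees fix the size of the Sylvester matrix, so its determinant is one
  polynomial expression in the coefficients for all \<open>s\<close>.\<close>

lemma poly_fun_resultant:
  assumes p: "poly_coeffs_fun n p" "\<And>s. degree (p s) = k" and q: "poly_coeffs_fun n q" "\<And>s. degree (q s) = l"
  shows "poly_fun n (\<lambda>s. resultant (p s) (q s))"
  unfolding resultant_sub resultant_sub_def p(2) q(2)
proof (rule poly_fun_det)
  fix i j assume "i < k + l" "j < k + l"
  then show "poly_fun n (\<lambda>s. sylvester_mat_sub k l (p s) (q s) $$ (i, j))"
    using p(1) q(1)
    by (simp add: sylvester_mat_sub_index poly_coeffs_fun_def poly_const poly_fun_if)
qed (rule sylvester_mat_sub_carrier)

text \<open>Only the summand with \<open>elim_denom w ^ 2\<close> reaches degree 5; its leading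
  coefficient is -9, whatever \<open>w\<close> is.\<close>

lemma degree_elim_quintic: "degree (elim_quintic w) = 5"
  by (simp add: elim_quintic_def elim_numer_def elim_denom_def power2_eq_square)

lemma poly_fun_genericity: "poly_fun 6 (\<lambda>s. genericity (coeff (wronskian_target s)))"
proof -
  have "poly_coeffs_fun 6 wronskian_target"
    unfolding wronskian_target_def [abs_def]
    by (intro poly_coeffs_fun_closed poly_fun_closed) auto
  then have w: "poly_fun 6 (\<lambda>s. coeff (wronskian_target s) i)" for i by (simp add: poly_coeffs_fun_def)
  have N: "poly_coeffs_fun 6 (\<lambda>s. elim_numer (coeff (wronskian_target s)))"
    and D: "poly_coeffs_fun 6 (\<lambda>s. elim_denom (coeff (wronskian_target s)))"
    unfolding elim_numer_def elim_denom_def by (intro poly_coeffs_fun_closed poly_fun_closed w)+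
  have Q: "poly_coeffs_fun 6 (\<lambda>s. elim_quintic (coeff (wronskian_target s)))"
    unfolding elim_quintic_def by (intro poly_coeffs_fun_closed poly_fun_closed w N D)
  have R: "poly_fun 6 (\<lambda>s. resultant (elim_quintic (coeff (wronskian_target s)))
      (pderiv (elim_quintic (coeff (wronskian_target s)))))"
    by (rule poly_fun_resultant[where k = 5 and l = 4])
      (simp_all add: Q poly_coeffs_fun_closed degree_elim_quintic degree_pderiv)
  have "poly_fun 6 (\<lambda>s. poly (elim_numer (coeff (wronskian_target s)))
      (coeff (wronskian_target s) 4 / 3 - coeff (wronskian_target s) 5 ^ 2 / 18))"
    unfolding elim_numer_def poly_pCons poly_0 by (intro poly_fun_closed w)
  then show ?thesis unfolding genericity_def by (intro poly_mult R)
qed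

section \<open>Counting complex roots, and a point where the genericity polynomial is
  nonzero\<close>

interpretation of_real_poly_hom: map_poly_inj_idom_hom "of_real :: real \<Rightarrow> complex" ..

text \<open>A nonzero resultant gives a real Bezout identity for \<open>p\<close> and its
  derivative. Mapped to the complex numbers, it excludes multiple roots, so the linear factorization
  has \<open>degree p\<close> distinct factors.\<close>

lemma card_roots_if_resultant_nonzero:
  fixes p :: "real poly"
  assumes "resultant p (pderiv p) \<noteq> 0" and p0: "p \<noteq> 0"
  shows "card {z::complex. poly (map_poly of_real p) z = 0} = degree p"
proof -
  let ?p = "map_poly complex_of_real p"
  have "degree (gcd p (pderiv p)) = 0" using assms(1) resultant_0_gcd by blast
  then have "is_unit (gcd p (pderiv p))" using p0 by (subst is_unit_iff_degree) simp_all
  then have "coprime p (pderiv p)" by (rule is_unit_gcd[THEN iffD1])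
  then have "fst (bezout_coefficients p (pderiv p)) * p + snd (bezout_coefficients p (pderiv p)) * pderiv p = 1"
    using bezout_coefficients_fst_snd[of p "pderiv p"] by simp
  then obtain u v where uv: "u * p + v * pderiv p = 1" by blast
  have "map_poly complex_of_real (u * p + v * pderiv p) = 1" unfolding uv by simp
  then have uvc: "map_poly of_real u * ?p + map_poly of_real v * pderiv ?p = 1"
    by (simp add: hom_distribs)
  have "rsquarefree ?p" unfolding rsquarefree_roots
  proof (intro allI notI)
    fix x assume "poly ?p x = 0 \<and> poly (pderiv ?p) x = 0"
    then show False using arg_cong[OF uvc, of "\<lambda>q. poly q x"] by simp
  qed
  then have "?p = smult (lead_coeff ?p) (\<Prod>z|poly ?p z = 0. [:-z, 1:])"
    by (rule complex_poly_decompose_rsquarefree[symmetric])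
  then have "degree ?p = degree (smult (lead_coeff ?p) (\<Prod>z|poly ?p z = 0. [:-z, 1:]))" by simp
  also have "\<dots> = card {z. poly ?p z = 0}" using p0 by (simp add: degree_prod_eq_sum_degree)
  finally show ?thesis by simp
qed

text \<open>Only nonvanishing of the polynomial is at stake, so the nodes may repeat. This choice
  gives the target x (x + 2) (x^2 - 1)^2 with small integer coefficients.\<close>

lemma genericity_witness:
  "genericity (coeff (wronskian_target (\<lambda>i. [-2, -1, -1, 0, 1, 1] ! i))) \<noteq> 0"
proof -
  let ?w = "coeff (wronskian_target (\<lambda>i. [-2, -1, -1, 0, 1, 1] ! i))"
  define w where "w = ?w"
  have W: "wronskian_target (\<lambda>i. [-2, -1, -1, 0, 1, 1] ! i) = [:0, 2, 1, -4, -2, 2, 1:]"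
  proof -
    have "{..<6::nat} = {0, 1, 2, 3, 4, 5}" by auto
    then show ?thesis by (simp add: wronskian_target_def one_pCons del: pCons_one)
  qed
  have w: "w 0 = 0" "w 1 = 2" "w 2 = 1" "w 3 = -4" "w 4 = -2" "w 5 = 2"
    unfolding w_def W by (simp_all add: numeral_eq_Suc)
  have Q: "elim_quintic w = [:0, 32/3, 68/3, 3, -18, -9:]"
    unfolding elim_quintic_def elim_numer_def elim_denom_def w by (simp add: power2_eq_square)
  \<comment> \<open>Bezout coefficients for the quintic and its derivative\<close>
  let ?u = "[:-70476, -208305, 177228, 259605:] :: real poly"
  let ?v = "[:528, 68232, 67635, -56214, -51921:] :: real poly"
  have "[:5632:] = ?u * elim_quintic w + ?v * pderiv (elim_quintic w)"
    unfolding Q by (simp add: pderiv_pCons)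
  also have "gcd (elim_quintic w) (pderiv (elim_quintic w)) dvd \<dots>"
    by (intro dvd_add dvd_mult gcd_dvd1 gcd_dvd2)
  finally have "degree (gcd (elim_quintic w) (pderiv (elim_quintic w))) \<le> degree [:5632::real:]"
    by (rule dvd_imp_degree_le) simp
  then have "resultant (elim_quintic w) (pderiv (elim_quintic w)) \<noteq> 0"
    by (simp add: resultant_0_gcd)
  moreover have "poly (elim_numer w) (w 4 / 3 - w 5 ^ 2 / 18) \<noteq> 0"
    unfolding elim_numer_def w by (simp add: power2_eq_square)
  ultimately show ?thesis by (simp add: genericity_def w_def)
qed

lemma map_poly_prod_linear_of_real:
  "map_poly complex_of_real (\<Prod>i\<in>I. [:- s i, 1:]) = (\<Prod>i\<in>I. [:- complex_of_real (s i), 1:])"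
  by (induction I rule: infinite_finite_induct) (simp_all add: hom_distribs)

section \<open>Solutions as pairs with prescribed Wronskian, and reality of one entry\<close>

lemma monic_poly_vanishing_on_nodes_iff:
  assumes inj: "inj_on s {..<6::nat}" and p: "degree p = 6" "lead_coeff p = 1"
  shows "(\<forall>k<6. poly p (complex_of_real (s k)) = 0) \<longleftrightarrow> p = map_poly of_real (wronskian_target s)"
proof -
  let ?q = "\<Prod>i<6. [:- complex_of_real (s i), 1:]"
  have q: "map_poly of_real (wronskian_target s) = ?q"
    unfolding wronskian_target_def by (rule map_poly_prod_linear_of_real)
  have deg: "degree ?q = 6" by (simp add: degree_prod_eq_sum_degree)
  have lc: "lead_coeff ?q = 1" unfolding lead_coeff_prod by simp
  have root: "poly ?q (of_real (s k)) = 0" if "k < 6" for k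
    using that by (auto simp: poly_prod)
  show ?thesis unfolding q
  proof
    assume R: "\<forall>k<6. poly p (complex_of_real (s k)) = 0"
    have "degree (p - ?q) \<le> 6" using p deg by (intro degree_diff_le) auto
    moreover have "coeff (p - ?q) 6 = 0" using p lc deg by simp
    ultimately have "degree (p - ?q) < 6"
      by (metis degree_0 le_neq_implies_less leading_coeff_0_iff zero_less_numeral)
    moreover have "card (complex_of_real ` s ` {..<6}) = 6"
      using inj by (simp add: card_image inj_on_def)
    ultimately have "p - ?q = 0"
      by (intro poly_eqI_degree[of "complex_of_real ` s ` {..<6}"]) (use R root in auto)
    then show "p = ?q" by simp
  qed (use root in auto)
qed

lemma mem_sol23_iff_wronskian:
  assumes inj: "inj_on s {..<6}" and X: "X \<in> carrier_mat 3 2"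
    and abc: "a = - X $$ (2,0)" "b = - X $$ (1,0)" "c = - X $$ (0,0)"
    and def': "d = - X $$ (2,1)" "e = - X $$ (1,1)" "f = - X $$ (0,1)"
  shows "X \<in> sol23 s \<longleftrightarrow> [:c * e - b * f, 2 * c * d - 2 * a * f, b * d - a * e - 3 * f, 4 * c - 2 * e, 3 * b - d, 2 * a, 1:]
      = map_poly of_real (wronskian_target s)"
proof -
  let ?p = "[:c * e - b * f, 2 * c * d - 2 * a * f, b * d - a * e - 3 * f, 4 * c - 2 * e, 3 * b - d, 2 * a, 1:]"
  have "phi 2 3 x X = poly ?p x" for x
    unfolding phi_2_3[OF X] wronskian_coeffs[symmetric] abc def' by simp
  then have "X \<in> sol23 s \<longleftrightarrow> (\<forall>k<6. poly ?p (of_real (s k)) = 0)"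
    using X by (simp add: sol23_def)
  also have "\<dots> \<longleftrightarrow> ?p = map_poly of_real (wronskian_target s)"
    by (rule monic_poly_vanishing_on_nodes_iff[OF inj]) simp_all
  finally show ?thesis .
qed

text \<open>Translation by the last node reduces to the case of a node at 0. Subtracting 4 \<sigma>
  times the shifted cubic removes the x^3 term of the shifted quartic without changing the
  Wronskian. Since \<open>a\<close> and \<sigma> are real, reality of \<open>b'\<close> passes to
  \<open>b\<close>.\<close>

lemma sol23_entry_real:
  assumes inj: "inj_on s {..<6}" and X: "X \<in> sol23 s"
  shows "X $$ (1, 0) \<in> \<real>"
proof -
  have X': "X \<in> carrier_mat 3 2" using X by (simp add: sol23_def)
  define a b c d e f where abc: "a = - X $$ (2,0)" "b = - X $$ (1,0)" "c = - X $$ (0,0)"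
    and def': "d = - X $$ (2,1)" "e = - X $$ (1,1)" "f = - X $$ (0,1)"
  have W: "[:c * e - b * f, 2 * c * d - 2 * a * f, b * d - a * e - 3 * f, 4 * c - 2 * e, 3 * b - d, 2 * a, 1:]
      = map_poly of_real (wronskian_target s)" (is "?p = _")
    using mem_sol23_iff_wronskian[OF inj X' abc def'] X by simp
  have "coeff ?p 5 = of_real (coeff (wronskian_target s) 5)" unfolding W by simp
  then have "2 * a \<in> \<real>" by (simp add: numeral_eq_Suc)
  then have "2 * a / 2 \<in> \<real>" by (intro Reals_divide) auto
  then have a_real: "a \<in> \<real>" by simp
  define \<sigma> where "\<sigma> = complex_of_real (s 5)"
  \<comment> \<open>The coefficients of \<open>f\<^sub>1(x + \<sigma>)\<close> and \<open>f\<^sub>2(x + \<sigma>) - 4\<sigma> f\<^sub>1(x + \<sigma>)\<close>\<close>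
  define a' where "a' = a + 3 * \<sigma>"
  define b' where "b' = 3 * \<sigma>^2 + 2 * a * \<sigma> + b"
  define c' where "c' = \<sigma>^3 + a * \<sigma>^2 + b * \<sigma> + c"
  define d' where "d' = 6 * \<sigma>^2 + d - 4 * \<sigma> * a'"
  define e' where "e' = 4 * \<sigma>^3 + 2 * d * \<sigma> + e - 4 * \<sigma> * b'"
  define f' where "f' = \<sigma>^4 + d * \<sigma>^2 + e * \<sigma> + f - 4 * \<sigma> * c'"
  have "b' \<in> \<real>"
  proof (rule wronskian_node_at_0_real)
    show "card {..<5::nat} = 5" by simp
    show "inj_on (\<lambda>i. s i - s 5) {..<5}" using inj by (auto simp: inj_on_def)
    show "s i - s 5 \<noteq> 0" if "i \<in> {..<5}" for i
      using inj that by (auto dest: inj_onD[of _ _ i 5])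
    fix x :: complex
    have "(x^3 + a' * x^2 + b' * x + c') * (4 * x^3 + 2 * d' * x + e')
      - (3 * x^2 + 2 * a' * x + b') * (x^4 + d' * x^2 + e' * x + f') = poly ?p (x + \<sigma>)"
      unfolding wronskian_coeffs[symmetric] a'_def b'_def c'_def d'_def e'_def f'_def
      by (simp add: algebra_simps power_numeral_reduce)
    also have "\<dots> = (\<Prod>i<6. x + \<sigma> - of_real (s i))"
      unfolding W wronskian_target_def map_poly_prod_linear_of_real by (simp add: poly_prod)
    also have "{..<6::nat} = insert 5 {..<5}" by auto
    also have "(\<Prod>i\<in>insert 5 {..<5::nat}. x + \<sigma> - of_real (s i)) = x * (\<Prod>i<5. x - of_real (s i - s 5))"
      by (simp add: \<sigma>_def algebra_simps)
    finally show "(x^3 + a' * x^2 + b' * x + c') * (4 * x^3 + 2 * d' * x + e')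
      - (3 * x^2 + 2 * a' * x + b') * (x^4 + d' * x^2 + e' * x + f') = x * (\<Prod>i<5. x - of_real (s i - s 5))" .
  qed
  moreover have "b = b' - 3 * \<sigma>^2 - 2 * a * \<sigma>" by (simp add: b'_def)
  ultimately have "b \<in> \<real>" using a_real by (auto simp: \<sigma>_def intro!: Reals_diff Reals_mult Reals_power)
  then show ?thesis unfolding abc by simp
qed

section \<open>Elimination of all unknowns except \<open>b\<close>\<close>

text \<open>The equations for \<open>w 2\<close> to \<open>w 5\<close> express \<open>a\<close>,
  \<open>d\<close>, \<open>e\<close>, \<open>f\<close> through \<open>b\<close> and
  \<open>c\<close>. The one for \<open>w 1\<close> becomes \<open>c * D b = N b\<close>, and the one
  for \<open>w 0\<close>, multiplied by \<open>D b ^ 2\<close>, becomes the quintic.\<close>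

lemma wronskian_system_elim:
  fixes w :: "nat \<Rightarrow> 'a::field_char_0"
  defines "D \<equiv> \<lambda>b. 3 * b - w 4 + w 5 ^ 2 / 6"
    and "N \<equiv> \<lambda>b. w 1 / 2 + w 5 / 6 * (b * (3 * b - w 4) + w 5 * w 3 / 4 - w 2)"
  assumes nz: "D b \<noteq> 0 \<or> N b \<noteq> 0"
  shows "c * e - b * f = w 0 \<and> 2 * c * d - 2 * a * f = w 1 \<and> b * d - a * e - 3 * f = w 2
      \<and> 4 * c - 2 * e = w 3 \<and> 3 * b - d = w 4 \<and> 2 * a = w 5 \<longleftrightarrow>
    2 * N b ^ 2 + N b * D b * (w 5 / 3 * b - w 3 / 2)
      - D b ^ 2 * (b * (b * (3 * b - w 4) + w 5 * w 3 / 4 - w 2) / 3 + w 0) = 0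
      \<and> a = w 5 / 2 \<and> d = 3 * b - w 4 \<and> c = N b / D b \<and> e = 2 * c - w 3 / 2
      \<and> f = (b * d - w 5 * c + w 5 * w 3 / 4 - w 2) / 3"
  (is "?sys \<longleftrightarrow> ?Q = 0 \<and> ?par")
proof -
  have par: "b * d - a * e - 3 * f = w 2 \<and> 4 * c - 2 * e = w 3 \<and> 3 * b - d = w 4 \<and> 2 * a = w 5 \<longleftrightarrow>
      a = w 5 / 2 \<and> d = 3 * b - w 4 \<and> e = 2 * c - w 3 / 2 \<and> f = (b * d - w 5 * c + w 5 * w 3 / 4 - w 2) / 3"
    (is "_ \<longleftrightarrow> ?par0")
  proof -
    have "a = w 5 / 2 \<longleftrightarrow> 2 * a = w 5" "d = 3 * b - w 4 \<longleftrightarrow> 3 * b - d = w 4"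
      "e = 2 * c - w 3 / 2 \<longleftrightarrow> 4 * c - 2 * e = w 3"
      by (auto simp: field_simps)
    moreover have "f = (b * d - w 5 * c + w 5 * w 3 / 4 - w 2) / 3 \<longleftrightarrow> b * d - a * e - 3 * f = w 2"
      if "a = w 5 / 2" "e = 2 * c - w 3 / 2"
    proof -
      have "a * e = w 5 * c - w 5 * w 3 / 4" unfolding that by (simp add: field_simps)
      then have eq: "b * d - w 5 * c + w 5 * w 3 / 4 - w 2 = b * d - a * e - w 2" by simp
      show ?thesis unfolding eq by (auto simp: field_simps)
    qed
    ultimately show ?thesis by blast
  qed
  have w1: "2 * c * d - 2 * a * f = w 1 \<longleftrightarrow> c * D b = N b" if ?par0
  proof -
    from that have A: "a = w 5 / 2" "d = 3 * b - w 4"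
      and f: "f = (b * d - w 5 * c + w 5 * w 3 / 4 - w 2) / 3" by auto
    have "2 * c * d - 2 * a * f - w 1 = 2 * (c * D b - N b)"
      unfolding D_def N_def f A by (simp add: field_simps power2_eq_square)
    then show ?thesis by auto
  qed
  have cD: "c * D b = N b \<longleftrightarrow> D b \<noteq> 0 \<and> c = N b / D b" using nz by (cases "D b = 0") (auto simp: field_simps)
  have w0: "c * e - b * f = w 0 \<longleftrightarrow> ?Q = 0" if ?par0 "D b \<noteq> 0" "c = N b / D b"
  proof -
    from that(1) have A: "d = 3 * b - w 4" "e = 2 * c - w 3 / 2"
      and f: "f = (b * d - w 5 * c + w 5 * w 3 / 4 - w 2) / 3" by auto
    have N: "N b = c * D b" using that by simp
    have "?Q = D b ^ 2 * (c * e - b * f - w 0)"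
      unfolding N f A by (simp add: field_simps power2_eq_square)
    then show ?thesis using that(2) by simp
  qed
  \<comment> \<open>At \<open>D b = 0\<close> the quintic reduces to \<open>2 * N b ^ 2\<close>,
    which \<open>nz\<close> keeps nonzero; hence the division in \<open>N b / D b\<close> is genuine
    at every root.\<close>
  have "D b \<noteq> 0" if "?Q = 0"
    using that nz by auto
  then show ?thesis using par w1 cD w0 by blast
qed

section \<open>Bijection between solutions and roots of the quintic\<close>

theorem mainTheorem2:
  shows "\<exists>P. poly_fun 6 P \<and> (\<exists>t. P t \<noteq> 0) \<and>
    (\<forall>s. inj_on s {..<6} \<and> P s \<noteq> 0 \<longrightarrow>
       finite (sol23 s) \<and> card (sol23 s) = 5 \<and>
       (\<forall>X\<in>sol23 s. \<forall>i<3. \<forall>j<2. X $$ (i, j) \<in> \<real>))"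
proof (intro exI conjI allI impI)
  show "poly_fun 6 (\<lambda>s. genericity (coeff (wronskian_target s)))" by (rule poly_fun_genericity)
  show "genericity (coeff (wronskian_target (\<lambda>i. [-2, -1, -1, 0, 1, 1] ! i))) \<noteq> 0"
    by (rule genericity_witness)
  fix s :: "nat \<Rightarrow> real"
  assume "inj_on s {..<6} \<and> genericity (coeff (wronskian_target s)) \<noteq> 0"
  then have inj: "inj_on s {..<6}" and gen: "genericity (coeff (wronskian_target s)) \<noteq> 0" by auto
  define w where "w n = complex_of_real (coeff (wronskian_target s) n)" for n
  define D where "D b = 3 * b - w 4 + w 5 ^ 2 / 6" for b
  define N where "N b = w 1 / 2 + w 5 / 6 * (b * (3 * b - w 4) + w 5 * w 3 / 4 - w 2)" for b
  define Q where "Q = map_poly complex_of_real (elim_quintic (coeff (wronskian_target s)))"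
  \<comment> \<open>\<open>g\<close> rebuilds the candidate solution from \<open>b\<close>; its
    columns hold the negated coefficients of the cubic and of the quartic, constant term
    first.\<close>
  define g where "g b = (let a = w 5 / 2; d = 3 * b - w 4; c = N b / D b; e = 2 * c - w 3 / 2;
      f = (b * d - w 5 * c + w 5 * w 3 / 4 - w 2) / 3
    in mat 3 2 (\<lambda>(i, j). - (if j = 0 then [c, b, a] ! i else [f, e, d] ! i)))" for b
  have w_real: "w n \<in> \<real>" for n by (simp add: w_def)
  have Q: "poly Q b = 2 * N b ^ 2 + N b * D b * (w 5 / 3 * b - w 3 / 2)
      - D b ^ 2 * (b * (b * (3 * b - w 4) + w 5 * w 3 / 4 - w 2) / 3 + w 0)" for b
  proof -
    have 1: "poly (map_poly of_real (elim_numer (coeff (wronskian_target s)))) b = N b"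
      unfolding elim_numer_def hom_distribs poly_pCons by (simp add: N_def w_def field_simps)
    have 2: "poly (map_poly of_real (elim_denom (coeff (wronskian_target s)))) b = D b"
      unfolding elim_denom_def hom_distribs poly_pCons by (simp add: D_def w_def field_simps)
    show ?thesis
      unfolding Q_def elim_quintic_def hom_distribs poly_add poly_diff poly_mult poly_power poly_smult 1 2 poly_pCons
      by (simp add: w_def field_simps)
  qed
  have nz: "D b \<noteq> 0 \<or> N b \<noteq> 0" for b
  proof (cases "D b = 0")
    case True
    then have b: "b = of_real (coeff (wronskian_target s) 4 / 3 - coeff (wronskian_target s) 5 ^ 2 / 18)"
      by (simp add: D_def w_def field_simps)
    have "N b = of_real (poly (elim_numer (coeff (wronskian_target s)))
        (coeff (wronskian_target s) 4 / 3 - coeff (wronskian_target s) 5 ^ 2 / 18))"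
      unfolding b by (simp add: N_def w_def elim_numer_def algebra_simps)
    then show ?thesis using gen by (simp add: genericity_def)
  qed simp
  have target: "map_poly complex_of_real (wronskian_target s) = [:w 0, w 1, w 2, w 3, w 4, w 5, 1:]"
  proof -
    have deg: "degree (wronskian_target s) = 6"
      by (simp add: wronskian_target_def degree_prod_eq_sum_degree)
    moreover have "lead_coeff (wronskian_target s) = 1"
      unfolding wronskian_target_def lead_coeff_prod by simp
    ultimately show ?thesis
      by (subst poly_eq_coeff_list_6) (simp_all add: w_def del: One_nat_def)
  qed
  have sol_iff: "X \<in> sol23 s \<longleftrightarrow> poly Q (- X $$ (1,0)) = 0 \<and> X = g (- X $$ (1,0))"
    if X: "X \<in> carrier_mat 3 2" for X
  proof -
    define a b c d e f where abc: "a = - X $$ (2,0)" "b = - X $$ (1,0)" "c = - X $$ (0,0)"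
      and def': "d = - X $$ (2,1)" "e = - X $$ (1,1)" "f = - X $$ (0,1)"
    have "X \<in> sol23 s \<longleftrightarrow> c * e - b * f = w 0 \<and> 2 * c * d - 2 * a * f = w 1 \<and> b * d - a * e - 3 * f = w 2
      \<and> 4 * c - 2 * e = w 3 \<and> 3 * b - d = w 4 \<and> 2 * a = w 5"
      unfolding mem_sol23_iff_wronskian[OF inj X abc def'] target pCons_eq_iff by blast
    also have "\<dots> \<longleftrightarrow> poly Q b = 0 \<and> a = w 5 / 2 \<and> d = 3 * b - w 4 \<and> c = N b / D b \<and> e = 2 * c - w 3 / 2
      \<and> f = (b * d - w 5 * c + w 5 * w 3 / 4 - w 2) / 3"
      unfolding Q unfolding N_def D_def
      by (rule wronskian_system_elim) (use nz[of b] in \<open>simp add: N_def D_def\<close>)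
    also have "(a = w 5 / 2 \<and> d = 3 * b - w 4 \<and> c = N b / D b \<and> e = 2 * c - w 3 / 2
      \<and> f = (b * d - w 5 * c + w 5 * w 3 / 4 - w 2) / 3) \<longleftrightarrow> X = g b"
    proof
      assume "X = g b"
      then show "a = w 5 / 2 \<and> d = 3 * b - w 4 \<and> c = N b / D b \<and> e = 2 * c - w 3 / 2
        \<and> f = (b * d - w 5 * c + w 5 * w 3 / 4 - w 2) / 3"
        unfolding abc(1,3) def' by (simp add: g_def Let_def numeral_eq_Suc)
    next
      assume par: "a = w 5 / 2 \<and> d = 3 * b - w 4 \<and> c = N b / D b \<and> e = 2 * c - w 3 / 2
        \<and> f = (b * d - w 5 * c + w 5 * w 3 / 4 - w 2) / 3"
      then have eqs: "w 5 / 2 = a" "3 * b - w 4 = d" "N b / D b = c" "2 * c - w 3 / 2 = e"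
        "(b * d - w 5 * c + w 5 * w 3 / 4 - w 2) / 3 = f" by simp_all
      have g: "g b = mat 3 2 (\<lambda>(i, j). - (if j = 0 then [c, b, a] ! i else [f, e, d] ! i))"
        unfolding g_def Let_def eqs ..
      show "X = g b" unfolding g
      proof (rule eq_matI)
        fix i j assume "i < dim_row (mat 3 2 (\<lambda>(i, j). - (if j = 0 then [c, b, a] ! i else [f, e, d] ! i)))"
          "j < dim_col (mat 3 2 (\<lambda>(i, j). - (if j = 0 then [c, b, a] ! i else [f, e, d] ! i)))"
        then have "i \<in> {0, 1, 2}" "j \<in> {0, 1}" by auto
        then show "X $$ (i, j) = mat 3 2 (\<lambda>(i, j). - (if j = 0 then [c, b, a] ! i else [f, e, d] ! i)) $$ (i, j)"
          by (auto simp: abc def')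
      qed (use X in auto)
    qed
    finally show ?thesis unfolding abc .
  qed
  have g_carrier: "g b \<in> carrier_mat 3 2" and g_entry: "- (g b $$ (1, 0)) = b" for b
    by (simp_all add: g_def Let_def)
  have "sol23 s = g ` {b. poly Q b = 0}"
  proof (intro equalityI subsetI)
    fix X assume X: "X \<in> sol23 s"
    then have "X \<in> carrier_mat 3 2" by (simp add: sol23_def)
    with X show "X \<in> g ` {b. poly Q b = 0}" using sol_iff by blast
  next
    fix X assume "X \<in> g ` {b. poly Q b = 0}"
    then show "X \<in> sol23 s" using sol_iff g_carrier g_entry by auto
  qed
  moreover have "inj_on g {b. poly Q b = 0}" by (rule inj_on_inverseI[of _ "\<lambda>X. - (X $$ (1, 0))"]) (rule g_entry)
  \<comment> \<open>The resultant factor of \<open>genericity\<close> makes the five roots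
    distinct.\<close>
  moreover have "card {b. poly Q b = 0} = 5"
    unfolding Q_def using gen degree_elim_quintic[of "coeff (wronskian_target s)"]
    by (subst card_roots_if_resultant_nonzero) (auto simp: genericity_def)
  ultimately show card: "card (sol23 s) = 5" by (simp add: card_image)
  then show "finite (sol23 s)" by (simp add: card_ge_0_finite)
  show "\<forall>X\<in>sol23 s. \<forall>i<3. \<forall>j<2. X $$ (i, j) \<in> \<real>"
  proof (intro ballI allI impI)
    fix X i j assume X: "X \<in> sol23 s" and "i < (3::nat)" "j < (2::nat)"
    then have i: "i \<in> {0, 1, 2}" and j: "j \<in> {0, 1}" by auto
    define b where "b = - X $$ (1, 0)"
    have b: "b \<in> \<real>" using sol23_entry_real[OF inj X] by (simp add: b_def)
    have "X = g b" using sol_iff[of X] X by (simp add: sol23_def b_def)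
    \<comment> \<open>Every entry of \<open>g b\<close> is a rational expression in \<open>b\<close>
      with real coefficients, so reality of \<open>b\<close> suffices.\<close>
    have D: "D b \<in> \<real>" and N: "N b \<in> \<real>"
      unfolding D_def N_def using b w_real
      by (auto intro!: Reals_diff Reals_add Reals_mult Reals_divide Reals_power)
    have "g b $$ (i, j) \<in> \<real>"
      using i j b w_real D N
      by (auto simp: g_def Let_def intro!: Reals_diff Reals_add Reals_mult Reals_divide)
    then show "X $$ (i, j) \<in> \<real>" using \<open>X = g b\<close> by simp
  qed
qed

end
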